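(* Let $(A,\mu,R,d)$ be a modified Rota-Baxter AssDer pair of weight $\kappa$. If $\mathcal{H}^2_{\mathrm{mRBAD}^\kappa}(A,A)=0$, then $(A,\mu,R,d)$ is rigid, i.e. every formal one-parameter deformation $(\mu_t,R_t,d_t)$ of $(A,\mu,R,d)$ is equivalent to the undeformed one $(\mu,R,d)$.
   Context: All vector spaces and linear maps are over a field $\mathbb{K}$, and $\kappa\in\mathbb{K}$ is fixed. A modified Rota-Baxter associative algebra of weight $\kappa$ is an associative (not necessarily unital) algebra $(A,\mu)$ with a linear map $R:A\to A$ such that $\mu(R(a),R(b))=R\big(\mu(R(a),b)+\mu(a,R(b))\big)+\kappa\,\mu(a,b)$ for all $a,b\in A$. A modified Rota-Baxter AssDer pair $(A,\mu,R,d)$ of weight $\kappa$ is such an algebra together with a derivation $d:A\to A$ of $(A,\mu)$ with $R\circ d=d\circ R$. Deformations. A formal one-parameter deformation of $(A,\mu,R,d)$ is a triple $(\mu_t,R_t,d_t)$ of formal power series $\mu_t=\sum_{i\ge0}\mu_it^i$, $R_t=\sum_{i\ge0}R_it^i$, $d_t=\sum_{i\ge0}d_it^i$ with $\mu_i\in\mathrm{Hom}(A^{\otimes2},A)$, $R_i,d_i\in\mathrm{Hom}(A,A)$, $\mu_0=\mu$, $R_0=R$, $d_0=d$, such that $(A[\![t]\!],\mu_t,R_t,d_t)$ (with $\mathbb{K}[\![t]\!]$-(bi)linearly extended maps) is a modified Rota-Baxter AssDer pair of weight $\kappa$ over $\mathbb{K}[\![t]\!]$: $\mu_t$ is associative,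 $R_t$ is a modified Rota-Baxter operator of weight $\kappa$, $d_t$ is a derivation and $R_t\circ d_t=d_t\circ R_t$. Two deformations $(\mu_t,R_t,d_t)$ and $(\mu_t',R_t',d_t')$ are equivalent if there is $\varphi_t=\sum_{i\ge0}\varphi_it^i$ with $\varphi_i\in\mathrm{Hom}(A,A)$, $\varphi_0=\mathrm{Id}$, such that $\varphi_t(\mu_t(a,b))=\mu_t'(\varphi_t(a),\varphi_t(b))$, $\varphi_t\circ R_t=R_t'\circ\varphi_t$ and $\varphi_t\circ d_t=d_t'\circ\varphi_t$. The undeformed one is the deformation with $\mu_t=\mu$, $R_t=R$, $d_t=d$. Cohomology of $(A,\mu,R,d)$ with coefficients in itself. For $n\ge1$ let $C^n(A;A)=\mathrm{Hom}(A^{\otimes n},A)$. For $f\in C^n(A;A)$ define $$\delta^n_{\mathrm{Hoch}}(f)(a_1,\dots,a_{n+1})=(-1)^{n+1}\mu(a_1,f(a_2,\dots,a_{n+1}))+\mu(f(a_1,\dots,a_n),a_{n+1})+\sum_{i=1}^n(-1)^{i+n+1}f(a_1,\dots,\mu(a_i,a_{i+1}),\dots,a_{n+1}),$$ $$\begin{aligned}\delta^n_{\mathrm{mHoch}}(f)(a_1,\dots,a_{n+1})=&(-1)^{n+1}\mu(R(a_1),f(a_2,\dots,a_{n+1}))-(-1)^{n+1}R(\mu(a_1,f(a_2,\dots,a_{n+1})))\\&+\mu(f(a_1,\dots,a_n),R(a_{n+1}))-R(\mu(f(a_1,\dots,a_n),a_{n+1}))\\&+\sum_{i=1}^n(-1)^{i+n+1}f(a_1,\dots,\mu(R(a_i),a_{i+1})+\mu(a_i,R(a_{i+1})),\dots,a_{n+1}),\end{aligned}$$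 $$\begin{aligned}\phi^n(f)(a_1,\dots,a_n)=&f(R(a_1),\dots,R(a_n))-\sum_{\substack{1\le i_1<\dots<i_r\le n\\ r\ \mathrm{odd}}}(-\kappa)^{\frac{r-1}{2}}R\big(f(R(a_1),\dots,a_{i_1},\dots,a_{i_r},\dots,R(a_n))\big)\\&+\sum_{\substack{1\le i_1<\dots<i_r\le n\\ r\ge2\ \mathrm{even}}}(-\kappa)^{\frac r2}f(R(a_1),\dots,a_{i_1},\dots,a_{i_r},\dots,R(a_n)),\end{aligned}$$ where in each summand the argument in position $j$ is $a_j$ if $j\in\{i_1,\dots,i_r\}$ and $R(a_j)$ otherwise. Let $C^1_{\mathrm{mRBAA}^\kappa}(A;A)=\mathrm{Hom}(A,A)$ and $C^n_{\mathrm{mRBAA}^\kappa}(A;A)=C^n(A;A)\oplus C^{n-1}(A;A)$ for $n\ge2$, with $\partial^1_{\mathrm{mRBAA}^\kappa}(f)=(\delta^1_{\mathrm{Hoch}}f,-\phi^1f)$ and $\partial^n_{\mathrm{mRBAA}^\kappa}(f,g)=(\delta^n_{\mathrm{Hoch}}f,-\delta^{n-1}_{\mathrm{mHoch}}g-\phi^nf)$ for $n\ge2$. For $f\in C^n(A;A)$ put $\Delta^n(f)=\sum_{i=1}^nf\circ(\mathrm{Id}\otimes\cdots\otimes d\otimes\cdots\otimes\mathrm{Id})-d\circ f$ ($d$ in the $i$-th place), and $\Delta^n(f,g)=(\Delta^nf,\Delta^{n-1}g)$ for $(f,g)\in C^n_{\mathrm{mRBAA}^\kappa}(A;A)$, $n\ge2$.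 Let $\mathfrak{C}^1_{\mathrm{mRBAD}^\kappa}(A;A)=\mathrm{Hom}(A,A)$, $\mathfrak{C}^n_{\mathrm{mRBAD}^\kappa}(A;A)=C^n_{\mathrm{mRBAA}^\kappa}(A;A)\times C^{n-1}_{\mathrm{mRBAA}^\kappa}(A;A)$ for $n\ge2$, $\mathfrak{D}^1_{\mathrm{mRBAD}^\kappa}(f)=(\partial^1_{\mathrm{mRBAA}^\kappa}f,-\Delta^1f)$, and $\mathfrak{D}^n_{\mathrm{mRBAD}^\kappa}(F,G)=(\partial^n_{\mathrm{mRBAA}^\kappa}F,\partial^{n-1}_{\mathrm{mRBAA}^\kappa}G+(-1)^n\Delta^nF)$ for $n\ge2$. This is a cochain complex, and $\mathcal{H}^2_{\mathrm{mRBAD}^\kappa}(A,A)=\ker\mathfrak{D}^2_{\mathrm{mRBAD}^\kappa}/\operatorname{im}\mathfrak{D}^1_{\mathrm{mRBAD}^\kappa}$. *)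

theory Defs
  imports
    "HOL-Computational_Algebra.Formal_Power_Series"
    "HOL-Library.Function_Algebras"
    "HOL-Library.Product_Plus"
begin

text \<open>
  The algebraic structures are defined over a commutative ring \<open>'k\<close>, since they are used both
  over the ground field and over its ring of formal power series. For a type \<open>'k\<close> of class
  \<open>field\<close> the locales \<open>module\<close> and \<open>vector_space\<close> coincide (\<open>module_iff_vector_space\<close>).
\<close>

locale mRB_algebra = module scale
  for scale :: "'k::comm_ring_1 \<Rightarrow> 'a::ab_group_add \<Rightarrow> 'a" (infixr \<open>*s\<close> 75) +
  fixes \<mu> :: "'a \<Rightarrow> 'a \<Rightarrow> 'a"
    and R :: "'a \<Rightarrow> 'a"
    and \<kappa> :: 'k
  assumes mu_linear_left: "module_hom scale scale (\<lambda>a. \<mu> a b)"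
    and mu_linear_right: "module_hom scale scale (\<lambda>b. \<mu> a b)"
    and mu_assoc: "\<mu> (\<mu> a b) c = \<mu> a (\<mu> b c)"
    and R_linear: "module_hom scale scale R"
    and modified_Rota_Baxter: "\<mu> (R a) (R b) = R (\<mu> (R a) b + \<mu> a (R b)) + \<kappa> *s \<mu> a b"

locale mRB_AssDer_pair = mRB_algebra scale \<mu> R \<kappa>
  for scale :: "'k::comm_ring_1 \<Rightarrow> 'a::ab_group_add \<Rightarrow> 'a" (infixr \<open>*s\<close> 75)
    and \<mu> :: "'a \<Rightarrow> 'a \<Rightarrow> 'a"
    and R d :: "'a \<Rightarrow> 'a"
    and \<kappa> :: 'k +
  assumes d_linear: "module_hom scale scale d"
    and derivation: "d (\<mu> a b) = \<mu> (d a) b + \<mu> a (d b)"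
    and R_d_commute: "R \<circ> d = d \<circ> R"


subsection \<open>Power series with coefficients in a module\<close>

text \<open>
  \<open>'a fps\<close> plays the role of \<open>A[[t]]\<close>, a module over \<open>'k fps\<close>, i.e. \<open>K[[t]]\<close>. A power series of
  linear or bilinear maps is the sequence of its coefficients, and \<open>fps_map\<close>, \<open>fps_map2\<close> are the
  maps it induces on \<open>A[[t]]\<close>.
\<close>

definition fps_scale ::
  "('k::comm_ring_1 \<Rightarrow> 'a::ab_group_add \<Rightarrow> 'a) \<Rightarrow> 'k fps \<Rightarrow> 'a fps \<Rightarrow> 'a fps" where
  "fps_scale scale c x = Abs_fps (\<lambda>n. \<Sum>i\<le>n. scale (fps_nth c i) (fps_nth x (n - i)))"

definition fps_map :: "(nat \<Rightarrow> 'a::ab_group_add \<Rightarrow> 'a) \<Rightarrow> 'a fps \<Rightarrow> 'a fps" where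
  "fps_map f x = Abs_fps (\<lambda>n. \<Sum>i\<le>n. f i (fps_nth x (n - i)))"

definition fps_map2 ::
  "(nat \<Rightarrow> 'a::ab_group_add \<Rightarrow> 'a \<Rightarrow> 'a) \<Rightarrow> 'a fps \<Rightarrow> 'a fps \<Rightarrow> 'a fps" where
  "fps_map2 m x y =
    Abs_fps (\<lambda>n. \<Sum>i\<le>n. \<Sum>j\<le>n - i. m i (fps_nth x j) (fps_nth y (n - i - j)))"

text \<open>A map regarded as a power series concentrated in degree 0.\<close>

definition fps_constant_map :: "'b::zero \<Rightarrow> nat \<Rightarrow> 'b" where
  "fps_constant_map f = (\<lambda>i. if i = 0 then f else 0)"


context mRB_AssDer_pair
begin

subsection \<open>Formal one-parameter deformations\<close>

definition deformation ::
  "(nat \<Rightarrow> 'a \<Rightarrow> 'a \<Rightarrow> 'a) \<Rightarrow> (nat \<Rightarrow> 'a \<Rightarrow> 'a) \<Rightarrow> (nat \<Rightarrow> 'a \<Rightarrow> 'a) \<Rightarrow> bool" where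
  "deformation \<mu>t Rt dt \<longleftrightarrow>
    (\<forall>i. (\<forall>b. module_hom scale scale (\<lambda>a. \<mu>t i a b)) \<and>
         (\<forall>a. module_hom scale scale (\<lambda>b. \<mu>t i a b)) \<and>
         module_hom scale scale (Rt i) \<and> module_hom scale scale (dt i)) \<and>
    \<mu>t 0 = \<mu> \<and> Rt 0 = R \<and> dt 0 = d \<and>
    mRB_AssDer_pair (fps_scale scale) (fps_map2 \<mu>t) (fps_map Rt) (fps_map dt) (fps_const \<kappa>)"

definition equivalent_deformations ::
  "(nat \<Rightarrow> 'a \<Rightarrow> 'a \<Rightarrow> 'a) \<Rightarrow> (nat \<Rightarrow> 'a \<Rightarrow> 'a) \<Rightarrow> (nat \<Rightarrow> 'a \<Rightarrow> 'a) \<Rightarrow>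
   (nat \<Rightarrow> 'a \<Rightarrow> 'a \<Rightarrow> 'a) \<Rightarrow> (nat \<Rightarrow> 'a \<Rightarrow> 'a) \<Rightarrow> (nat \<Rightarrow> 'a \<Rightarrow> 'a) \<Rightarrow> bool" where
  "equivalent_deformations \<mu>t Rt dt \<mu>t' Rt' dt' \<longleftrightarrow>
    (\<exists>\<phi> :: nat \<Rightarrow> 'a \<Rightarrow> 'a.
      (\<forall>i. module_hom scale scale (\<phi> i)) \<and> \<phi> 0 = id \<and>
      (\<forall>a b. fps_map \<phi> (fps_map2 \<mu>t a b) = fps_map2 \<mu>t' (fps_map \<phi> a) (fps_map \<phi> b)) \<and>
      fps_map \<phi> \<circ> fps_map Rt = fps_map Rt' \<circ> fps_map \<phi> \<and>
      fps_map \<phi> \<circ> fps_map dt = fps_map dt' \<circ> fps_map \<phi>)"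

definition rigid :: bool where
  "rigid \<longleftrightarrow>
    (\<forall>\<mu>t Rt dt. deformation \<mu>t Rt dt \<longrightarrow>
      equivalent_deformations \<mu>t Rt dt
        (fps_constant_map \<mu>) (fps_constant_map R) (fps_constant_map d))"


subsection \<open>Hochschild-type cochains\<close>

text \<open>
  An element of \<open>Hom(A\<^sup>\<otimes>\<^sup>n, A)\<close> is a function on argument lists that is multilinear on the lists of
  length \<open>n\<close> and, so that equality of cochains is equality of functions, 0 on all other lists.
  List positions count from 0: the argument \<open>a\<^sub>i\<close> is \<open>as ! (i - 1)\<close>.
\<close>

definition cochains :: "nat \<Rightarrow> ('a list \<Rightarrow> 'a) set" where
  "cochains n =
    {f. (\<forall>as. length as = n \<longrightarrow> (\<forall>i<n. module_hom scale scale (\<lambda>x. f (as[i := x])))) \<and>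
        (\<forall>as. length as \<noteq> n \<longrightarrow> f as = 0)}"

definition hoch :: "nat \<Rightarrow> ('a list \<Rightarrow> 'a) \<Rightarrow> 'a list \<Rightarrow> 'a" where
  "hoch n f = (\<lambda>as. if length as = n + 1 then
      (- 1) ^ (n + 1) *s \<mu> (hd as) (f (tl as))
      + \<mu> (f (butlast as)) (last as)
      + (\<Sum>i = 1..n. (- 1) ^ (i + n + 1) *s
          f (take (i - 1) as @ [\<mu> (as ! (i - 1)) (as ! i)] @ drop (i + 1) as))
    else 0)"

definition mhoch :: "nat \<Rightarrow> ('a list \<Rightarrow> 'a) \<Rightarrow> 'a list \<Rightarrow> 'a" where
  "mhoch n f = (\<lambda>as. if length as = n + 1 then
      (- 1) ^ (n + 1) *s \<mu> (R (hd as)) (f (tl as))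
      - (- 1) ^ (n + 1) *s R (\<mu> (hd as) (f (tl as)))
      + \<mu> (f (butlast as)) (R (last as))
      - R (\<mu> (f (butlast as)) (last as))
      + (\<Sum>i = 1..n. (- 1) ^ (i + n + 1) *s
          f (take (i - 1) as
             @ [\<mu> (R (as ! (i - 1))) (as ! i) + \<mu> (as ! (i - 1)) (R (as ! i))]
             @ drop (i + 1) as))
    else 0)"

text \<open>\<open>R_except S as\<close> applies \<open>R\<close> to the entries of \<open>as\<close> at the positions outside \<open>S\<close>.\<close>

definition R_except :: "nat set \<Rightarrow> 'a list \<Rightarrow> 'a list" where
  "R_except S as = map (\<lambda>j. if j \<in> S then as ! j else R (as ! j)) [0..<length as]"

definition phi :: "nat \<Rightarrow> ('a list \<Rightarrow> 'a) \<Rightarrow> 'a list \<Rightarrow> 'a" where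
  "phi n f = (\<lambda>as. if length as = n then
      f (map R as)
      - (\<Sum>S | S \<subseteq> {..<n} \<and> odd (card S).
          (- \<kappa>) ^ ((card S - 1) div 2) *s R (f (R_except S as)))
      + (\<Sum>S | S \<subseteq> {..<n} \<and> even (card S) \<and> 2 \<le> card S.
          (- \<kappa>) ^ (card S div 2) *s f (R_except S as))
    else 0)"

definition Delta :: "nat \<Rightarrow> ('a list \<Rightarrow> 'a) \<Rightarrow> 'a list \<Rightarrow> 'a" where
  "Delta n f = (\<lambda>as. if length as = n then
      (\<Sum>i<n. f (as[i := d (as ! i)])) - d (f as)
    else 0)"


subsection \<open>The complex of the modified Rota-Baxter algebra\<close>

text \<open>
  All complexes start in degree 1, where the cochain group is \<open>Hom(A, A)\<close> without a second
  summand. To have a single type of cochains, \<open>f\<close> in degree 1 is written \<open>(f, 0)\<close>. The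
  definitions below are meaningful for \<open>n \<ge> 1\<close> only.
\<close>

definition mRBAA_cochains :: "nat \<Rightarrow> (('a list \<Rightarrow> 'a) \<times> ('a list \<Rightarrow> 'a)) set" where
  "mRBAA_cochains n = (if n = 1 then cochains 1 \<times> {0} else cochains n \<times> cochains (n - 1))"

definition mRBAA_diff ::
  "nat \<Rightarrow> ('a list \<Rightarrow> 'a) \<times> ('a list \<Rightarrow> 'a) \<Rightarrow> ('a list \<Rightarrow> 'a) \<times> ('a list \<Rightarrow> 'a)" where
  "mRBAA_diff n = (\<lambda>(f, g).
    if n = 1 then (hoch 1 f, - phi 1 f)
    else (hoch n f, - mhoch (n - 1) g - phi n f))"

definition mRBAA_Delta ::
  "nat \<Rightarrow> ('a list \<Rightarrow> 'a) \<times> ('a list \<Rightarrow> 'a) \<Rightarrow> ('a list \<Rightarrow> 'a) \<times> ('a list \<Rightarrow> 'a)" where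
  "mRBAA_Delta n = (\<lambda>(f, g). if n = 1 then (Delta 1 f, 0) else (Delta n f, Delta (n - 1) g))"


subsection \<open>The complex of the modified Rota-Baxter AssDer pair\<close>

definition mRBAD_cochains ::
  "nat \<Rightarrow> ((('a list \<Rightarrow> 'a) \<times> ('a list \<Rightarrow> 'a)) \<times> (('a list \<Rightarrow> 'a) \<times> ('a list \<Rightarrow> 'a))) set" where
  "mRBAD_cochains n =
    (if n = 1 then mRBAA_cochains 1 \<times> {0} else mRBAA_cochains n \<times> mRBAA_cochains (n - 1))"

definition mRBAD_diff ::
  "nat \<Rightarrow> (('a list \<Rightarrow> 'a) \<times> ('a list \<Rightarrow> 'a)) \<times> (('a list \<Rightarrow> 'a) \<times> ('a list \<Rightarrow> 'a))
       \<Rightarrow> (('a list \<Rightarrow> 'a) \<times> ('a list \<Rightarrow> 'a)) \<times> (('a list \<Rightarrow> 'a) \<times> ('a list \<Rightarrow> 'a))" where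
  "mRBAD_diff n = (\<lambda>(F, G).
    if n = 1 then (mRBAA_diff 1 F, - mRBAA_Delta 1 F)
    else (mRBAA_diff n F,
          mRBAA_diff (n - 1) G + (if even n then mRBAA_Delta n F else - mRBAA_Delta n F)))"

definition mRBAD_cocycles ::
  "nat \<Rightarrow> ((('a list \<Rightarrow> 'a) \<times> ('a list \<Rightarrow> 'a)) \<times> (('a list \<Rightarrow> 'a) \<times> ('a list \<Rightarrow> 'a))) set" where
  "mRBAD_cocycles n = {z \<in> mRBAD_cochains n. mRBAD_diff n z = 0}"

definition mRBAD_coboundaries ::
  "nat \<Rightarrow> ((('a list \<Rightarrow> 'a) \<times> ('a list \<Rightarrow> 'a)) \<times> (('a list \<Rightarrow> 'a) \<times> ('a list \<Rightarrow> 'a))) set" where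
  "mRBAD_coboundaries n =
    (if n \<le> 1 then {0} else mRBAD_diff (n - 1) ` mRBAD_cochains (n - 1))"

text \<open>The quotient \<open>ker / im\<close> is the set of classes of cocycles modulo coboundaries.\<close>

definition cohomologous ::
  "nat \<Rightarrow> ((('a list \<Rightarrow> 'a) \<times> ('a list \<Rightarrow> 'a)) \<times> (('a list \<Rightarrow> 'a) \<times> ('a list \<Rightarrow> 'a))) rel" where
  "cohomologous n =
    {(x, y) \<in> mRBAD_cocycles n \<times> mRBAD_cocycles n. x - y \<in> mRBAD_coboundaries n}"

definition cohomology ::
  "nat \<Rightarrow> ((('a list \<Rightarrow> 'a) \<times> ('a list \<Rightarrow> 'a)) \<times> (('a list \<Rightarrow> 'a) \<times> ('a list \<Rightarrow> 'a))) set set" where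
  "cohomology n = mRBAD_cocycles n // cohomologous n"

definition cohomology_class ::
  "nat \<Rightarrow> (('a list \<Rightarrow> 'a) \<times> ('a list \<Rightarrow> 'a)) \<times> (('a list \<Rightarrow> 'a) \<times> ('a list \<Rightarrow> 'a))
       \<Rightarrow> ((('a list \<Rightarrow> 'a) \<times> ('a list \<Rightarrow> 'a)) \<times> (('a list \<Rightarrow> 'a) \<times> ('a list \<Rightarrow> 'a))) set" where
  "cohomology_class n z = cohomologous n `` {z}"

end

end

theory Submission
  imports Defs
begin

text \<open>
  The coefficients of the equivalence \<open>\<phi>\<^sub>t\<close> are found one after the other. Suppose that
  \<open>\<phi>\<^sub>0 = id, \<phi>\<^sub>1, \<dots>, \<phi>\<^sub>n\<^sub>-\<^sub>1\<close> satisfy the equations of an equivalence modulo \<open>t\<^sup>n\<close>, so that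
  \<open>\<phi>(\<mu>\<^sub>t(a, b)) = \<mu>(\<phi> a, \<phi> b) + t\<^sup>n E(a, b)\<close>, \<open>\<phi>(R\<^sub>t a) = R(\<phi> a) + t\<^sup>n G(a)\<close> and
  \<open>\<phi>(d\<^sub>t a) = d(\<phi> a) + t\<^sup>n H(a)\<close> modulo \<open>t\<^sup>n\<^sup>+\<^sup>1\<close>. Applying \<open>\<phi>\<close> to the axioms of the deformed
  pair and comparing coefficients of \<open>t\<^sup>n\<close> shows that \<open>((E, G), (H, 0))\<close> is a 2-cocycle; \<open>\<phi>\<close> need
  not be inverted for this. It is the coboundary of some \<open>\<psi>\<close>, and \<open>\<phi>\<^sub>n = \<psi>\<close> makes the equations
  hold modulo \<open>t\<^sup>n\<^sup>+\<^sup>1\<close>.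
\<close>

subsection \<open>Maps on power series that are linear in the formal parameter\<close>

text \<open>Multiplication by \<open>t\<close>; the coefficients carry no ring structure, so \<open>fps_X\<close> is unavailable.\<close>

definition fps_delay :: "'a::zero fps \<Rightarrow> 'a fps" where
  "fps_delay x = Abs_fps (\<lambda>n. case n of 0 \<Rightarrow> 0 | Suc m \<Rightarrow> fps_nth x m)"

lemma fps_delay_nth_0 [simp]: "fps_nth (fps_delay x) 0 = 0"
  and fps_delay_nth_Suc [simp]: "fps_nth (fps_delay x) (Suc n) = fps_nth x n"
  by (simp_all add: fps_delay_def)

lemma fps_const_plus_delay:
  fixes x :: "'a::monoid_add fps"
  shows "x = fps_const (fps_nth x 0) + fps_delay (fps_shift 1 x)"
proof (rule fps_ext)
  fix n
  show "fps_nth x n = fps_nth (fps_const (fps_nth x 0) + fps_delay (fps_shift 1 x)) n"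
    by (cases n) simp_all
qed

text \<open>Additivity and compatibility with multiplication by \<open>t\<close> are all that
  reduction to constant series uses; scalars do not enter.\<close>

definition t_linear :: "('a::ab_group_add fps \<Rightarrow> 'b::ab_group_add fps) \<Rightarrow> bool" where
  "t_linear F \<longleftrightarrow> additive F \<and> (\<forall>x. F (fps_delay x) = fps_delay (F x))"

lemma t_linear_additive: "t_linear F \<Longrightarrow> additive F"
  by (simp add: t_linear_def)

lemma t_linear_compose: "t_linear F \<Longrightarrow> t_linear G \<Longrightarrow> t_linear (\<lambda>x. F (G x))"
  by (simp add: t_linear_def additive_def)

lemma t_linear_diff:
  assumes "t_linear F" "t_linear G"
  shows "t_linear (\<lambda>x. F x - G x)"
  unfolding t_linear_def
proof (intro conjI allI)
  show "additive (\<lambda>x. F x - G x)"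
    using assms by (simp add: t_linear_def additive_def)
next
  fix x
  have "F (fps_delay x) - G (fps_delay x) = fps_delay (F x) - fps_delay (G x)"
    using assms by (simp add: t_linear_def)
  also have "\<dots> = fps_delay (F x - G x)"
  proof (rule fps_ext)
    fix n
    show "fps_nth (fps_delay (F x) - fps_delay (G x)) n = fps_nth (fps_delay (F x - G x)) n"
      by (cases n) simp_all
  qed
  finally show "F (fps_delay x) - G (fps_delay x) = fps_delay (F x - G x)" .
qed

text \<open>Write \<open>x = x0 + t x'\<close> with \<open>x0\<close> constant, so
  \<open>F x = F x0 + t F x'\<close>. By induction, the coefficient of \<open>F x'\<close> one
  degree lower is a value on a constant, where \<open>vanish\<close> gives 0. Tests on constants
  thus settle all series up to degree \<open>n\<close>.\<close>

lemma t_linear_nth: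
  assumes F: "t_linear F"
    and vanish: "\<And>a k. k < n \<Longrightarrow> fps_nth (F (fps_const a)) k = 0"
    and "k \<le> n"
  shows "fps_nth (F x) k = fps_nth (F (fps_const (fps_nth x 0))) k"
  using \<open>k \<le> n\<close>
proof (induction k arbitrary: x)
  \<comment> \<open>Stated for every \<open>x\<close>, since the induction hypothesis is applied to
    the shifted series.\<close>
  have decompose: "F x = F (fps_const (fps_nth x 0)) + fps_delay (F (fps_shift 1 x))" for x
    using F fps_const_plus_delay [of x] by (metis additive.add t_linear_def)
  {
    case 0
    show ?case by (subst decompose) simp
  next
    case (Suc k)
    then have "fps_nth (F (fps_shift 1 x)) k = 0"
      by (simp add: vanish)
    then show ?case by (subst decompose) simp
  }
qed

text \<open>The one-variable lemma is used in each argument in turn; its result for the left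
  argument supplies the vanishing hypothesis for the right one.\<close>

lemma t_bilinear_nth:
  assumes left: "\<And>y. t_linear (\<lambda>x. B x y)" and right: "\<And>x. t_linear (B x)"
    and vanish: "\<And>a b k. k < n \<Longrightarrow> fps_nth (B (fps_const a) (fps_const b)) k = 0"
    and "k \<le> n"
  shows "fps_nth (B x y) k = fps_nth (B (fps_const (fps_nth x 0)) (fps_const (fps_nth y 0))) k"
proof -
  have const_right: "fps_nth (B x (fps_const b)) k
      = fps_nth (B (fps_const (fps_nth x 0)) (fps_const b)) k" if "k \<le> n" for b k
    by (rule t_linear_nth [OF left]) (use vanish that in auto)
  have "fps_nth (B x y) k = fps_nth (B x (fps_const (fps_nth y 0))) k"
    by (rule t_linear_nth [OF right]) (use vanish const_right \<open>k \<le> n\<close> in auto)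
  then show ?thesis
    using const_right \<open>k \<le> n\<close> by simp
qed

section \<open>Coefficients and t-linearity of the induced maps\<close>

lemma fps_map_nth: "fps_nth (fps_map f x) n = (\<Sum>i\<le>n. f i (fps_nth x (n - i)))"
  by (simp add: fps_map_def)

lemma fps_map2_nth: "fps_nth (fps_map2 m x y) n =
    (\<Sum>i\<le>n. \<Sum>j\<le>n - i. m i (fps_nth x j) (fps_nth y (n - i - j)))"
  by (simp add: fps_map2_def)

lemma fps_map_constant_nth [simp]:
  "fps_nth (fps_map (fps_constant_map f) x) n = f (fps_nth x n)"
proof -
  have "fps_nth (fps_map (fps_constant_map f) x) n
      = (\<Sum>i\<le>n. if i = 0 then f (fps_nth x (n - i)) else 0)"
    unfolding fps_map_nth by (rule sum.cong) (auto simp: fps_constant_map_def)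
  then show ?thesis by simp
qed

lemma fps_map_fps_const_nth:
  assumes "\<And>i. additive (f i)"
  shows "fps_nth (fps_map f (fps_const a)) n = f n a"
proof -
  have "fps_nth (fps_map f (fps_const a)) n = (\<Sum>i\<le>n. if i = n then f n a else 0)"
    unfolding fps_map_nth by (rule sum.cong) (auto simp: additive.zero [OF assms])
  then show ?thesis by simp
qed

lemma fps_map2_fps_const_nth:
  assumes "\<And>i b. additive (\<lambda>a. m i a b)" and "\<And>i a. additive (m i a)"
  shows "fps_nth (fps_map2 m (fps_const a) (fps_const b)) n = m n a b"
proof -
  have inner: "(\<Sum>j\<le>n - i. m i (fps_nth (fps_const a) j) (fps_nth (fps_const b) (n - i - j)))
      = m i a (fps_nth (fps_const b) (n - i))" for i
  proof -
    have "(\<Sum>j\<le>n - i. m i (fps_nth (fps_const a) j) (fps_nth (fps_const b) (n - i - j)))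
        = (\<Sum>j\<le>n - i. if j = 0 then m i a (fps_nth (fps_const b) (n - i)) else 0)"
      by (rule sum.cong) (auto simp: additive.zero [OF assms(1)])
    then show ?thesis by simp
  qed
  have "(\<Sum>i\<le>n. m i a (fps_nth (fps_const b) (n - i))) = (\<Sum>i\<le>n. if i = n then m n a b else 0)"
    by (rule sum.cong) (auto simp: additive.zero [OF assms(2)])
  then show ?thesis
    unfolding fps_map2_nth inner by simp
qed

lemma fps_map2_constant_nth:
  "fps_nth (fps_map2 (fps_constant_map m) x y) n
    = (\<Sum>j\<le>n. m (fps_nth x j) (fps_nth y (n - j)))"
proof -
  have "fps_nth (fps_map2 (fps_constant_map m) x y) n
      = (\<Sum>i\<le>n. if i = 0 then \<Sum>j\<le>n. m (fps_nth x j) (fps_nth y (n - j)) else 0)"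
    unfolding fps_map2_nth by (rule sum.cong) (auto simp: fps_constant_map_def)
  then show ?thesis by simp
qed

lemma t_linear_fps_map:
  assumes "\<And>i. additive (f i)"
  shows "t_linear (fps_map f)"
  unfolding t_linear_def
proof (intro conjI allI)
  show "additive (fps_map f)"
    by (rule additive.intro, rule fps_ext)
      (simp add: fps_map_nth additive.add [OF assms] sum.distrib)
next
  fix x
  show "fps_map f (fps_delay x) = fps_delay (fps_map f x)"
  proof (rule fps_ext)
    fix n
    show "fps_nth (fps_map f (fps_delay x)) n = fps_nth (fps_delay (fps_map f x)) n"
      by (cases n) (auto simp: fps_map_nth Suc_diff_le additive.zero [OF assms] intro!: sum.cong)
  qed
qed

lemma t_linear_fps_map2_left:
  assumes "\<And>i b. additive (\<lambda>a. m i a b)"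
  shows "t_linear (\<lambda>x. fps_map2 m x y)"
  unfolding t_linear_def
proof (intro conjI allI)
  show "additive (\<lambda>x. fps_map2 m x y)"
    by (rule additive.intro, rule fps_ext)
      (simp add: fps_map2_nth additive.add [OF assms] sum.distrib)
next
  fix x
  show "fps_map2 m (fps_delay x) y = fps_delay (fps_map2 m x y)"
  proof (rule fps_ext)
    fix n
    show "fps_nth (fps_map2 m (fps_delay x) y) n = fps_nth (fps_delay (fps_map2 m x y)) n"
    proof (cases n)
      case 0
      then show ?thesis by (simp add: fps_map2_nth additive.zero [OF assms])
    next
      case (Suc p)
      \<comment> \<open>Delaying \<open>x\<close> kills the term \<open>j = 0\<close> and shifts the
        others by one. The outer term \<open>i = Suc p\<close> consists of \<open>j = 0\<close>
        only, so it vanishes as well.\<close>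
      have "(\<Sum>j\<le>Suc p - i. m i (fps_nth (fps_delay x) j) (fps_nth y (Suc p - i - j)))
          = (\<Sum>j\<le>p - i. m i (fps_nth x j) (fps_nth y (p - i - j)))" if "i \<le> p" for i
        using that
        by (simp add: Suc_diff_le sum.atMost_Suc_shift additive.zero [OF assms]
            del: sum.atMost_Suc)
      then show ?thesis
        by (simp add: Suc fps_map2_nth additive.zero [OF assms])
    qed
  qed
qed

lemma t_linear_fps_map2_right:
  assumes "\<And>i a. additive (m i a)"
  shows "t_linear (fps_map2 m x)"
  unfolding t_linear_def
proof (intro conjI allI)
  show "additive (fps_map2 m x)"
    by (rule additive.intro, rule fps_ext)
      (simp add: fps_map2_nth additive.add [OF assms] sum.distrib)
next
  fix y
  show "fps_map2 m x (fps_delay y) = fps_delay (fps_map2 m x y)"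
  proof (rule fps_ext)
    fix n
    show "fps_nth (fps_map2 m x (fps_delay y)) n = fps_nth (fps_delay (fps_map2 m x y)) n"
      by (cases n) (auto simp: fps_map2_nth Suc_diff_le additive.zero [OF assms]
          intro!: sum.cong)
  qed
qed

text \<open>In degree \<open>n\<close> a change of one factor in degree \<open>n\<close> meets only
  the constant term of the other. As \<open>0 < n\<close>, the product of both changes would appear
  in degree \<open>2n\<close> and does not contribute.\<close>

lemma fps_map2_constant_perturb:
  assumes l: "\<And>b. additive (\<lambda>a. m a b)" and r: "\<And>a. additive (m a)" and "0 < n"
    and x: "\<And>k. k < n \<Longrightarrow> fps_nth x k = fps_nth x' k"
    and y: "\<And>k. k < n \<Longrightarrow> fps_nth y k = fps_nth y' k"
  shows "fps_nth (fps_map2 (fps_constant_map m) x y) n =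
    fps_nth (fps_map2 (fps_constant_map m) x' y') n
    + m (fps_nth x n - fps_nth x' n) (fps_nth y 0)
    + m (fps_nth x 0) (fps_nth y n - fps_nth y' n)"
proof -
  obtain p where n: "n = Suc p" using \<open>0 < n\<close> by (cases n) auto
  \<comment> \<open>Both indices lie strictly between 0 and \<open>n\<close>, where the series
    agree; only the two end terms of the convolution change.\<close>
  have "(\<Sum>j<p. m (fps_nth x (Suc j)) (fps_nth y (p - j)))
      = (\<Sum>j<p. m (fps_nth x' (Suc j)) (fps_nth y' (p - j)))"
    by (rule sum.cong) (auto simp: n x y)
  moreover have "fps_nth x 0 = fps_nth x' 0" "fps_nth y 0 = fps_nth y' 0"
    using \<open>0 < n\<close> x y by auto
  moreover have ends: "(\<Sum>j\<le>n. h j) = h 0 + (\<Sum>j<p. h (Suc j)) + h n" for h :: "nat \<Rightarrow> 'a"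
    using sum.atMost_shift [of h p] by (simp add: n)
  ultimately show ?thesis
    unfolding fps_map2_constant_nth ends
    by (simp add: n additive.diff [OF l] additive.diff [OF r])
qed

lemma fps_map2_constant_assoc:
  assumes l: "\<And>b. additive (\<lambda>a. m a b)" and r: "\<And>a. additive (m a)"
    and assoc: "\<And>a b c. m (m a b) c = m a (m b c)"
  shows "fps_map2 (fps_constant_map m) (fps_map2 (fps_constant_map m) x y) z =
    fps_map2 (fps_constant_map m) x (fps_map2 (fps_constant_map m) y z)"
proof (rule fps_ext)
  fix n
  have "(\<Sum>j\<le>n. \<Sum>i\<le>j. m (m (fps_nth x i) (fps_nth y (j - i))) (fps_nth z (n - j))) =
      (\<Sum>j\<le>n. \<Sum>i\<le>n - j. m (m (fps_nth x j) (fps_nth y i)) (fps_nth z (n - j - i)))"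
    \<comment> \<open>A pure reindexing of a sum over triples with total degree \<open>n\<close>,
      valid for summands in any commutative additive monoid.\<close>
    using fps_mult_assoc_lemma [of "\<lambda>i j k. m (m (fps_nth x i) (fps_nth y j)) (fps_nth z k)" n n]
    by (simp add: atLeast0AtMost)
  then show "fps_nth (fps_map2 (fps_constant_map m) (fps_map2 (fps_constant_map m) x y) z) n =
      fps_nth (fps_map2 (fps_constant_map m) x (fps_map2 (fps_constant_map m) y z)) n"
    by (simp add: fps_map2_constant_nth additive.sum [OF l] additive.sum [OF r] assoc)
qed

lemma fps_map_cong_nth:
  "(\<And>i. i \<le> n \<Longrightarrow> f i = g i) \<Longrightarrow> fps_nth (fps_map f x) n = fps_nth (fps_map g x) n"
  by (simp add: fps_map_nth)

lemma fps_map_fun_upd_nth: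
  assumes "f n = 0"
  shows "fps_nth (fps_map (f(n := g)) x) n = fps_nth (fps_map f x) n + g (fps_nth x 0)"
  using assms by (cases n) (auto simp: fps_map_nth intro!: sum.cong)


subsection \<open>Cochains in low degree\<close>

context mRB_AssDer_pair
begin

definition unary_cochain :: "('a \<Rightarrow> 'a) \<Rightarrow> 'a list \<Rightarrow> 'a" where
  "unary_cochain f = (\<lambda>as. if length as = 1 then f (as ! 0) else 0)"

definition binary_cochain :: "('a \<Rightarrow> 'a \<Rightarrow> 'a) \<Rightarrow> 'a list \<Rightarrow> 'a" where
  "binary_cochain f = (\<lambda>as. if length as = 2 then f (as ! 0) (as ! 1) else 0)"

lemma unary_cochain_in_cochains:
  "module_hom scale scale f \<Longrightarrow> unary_cochain f \<in> cochains 1"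
  by (auto simp: cochains_def unary_cochain_def)

lemma binary_cochain_in_cochains:
  assumes "\<And>b. module_hom scale scale (\<lambda>a. f a b)" "\<And>a. module_hom scale scale (f a)"
  shows "binary_cochain f \<in> cochains 2"
  using assms by (auto simp: cochains_def binary_cochain_def less_2_cases_iff)

lemma cochains_1_module_hom:
  assumes "f \<in> cochains 1"
  shows "module_hom scale scale (\<lambda>a. f [a])"
proof -
  have "\<forall>as. length as = 1 \<longrightarrow> (\<forall>i<1. module_hom scale scale (\<lambda>x. f (as[i := x])))"
    using assms [unfolded cochains_def mem_Collect_eq] by (rule conjunct1)
  \<comment> \<open>Any one-element list serves, as its only entry is overwritten.\<close>
  from this [THEN spec, of "[undefined]"] show ?thesis by simp
qed

lemma zero_in_cochains: "0 \<in> cochains n"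
  by (simp add: cochains_def module_hom_iff module_axioms)

lemma hoch_1: "hoch 1 f [a, b] = \<mu> a (f [b]) + \<mu> (f [a]) b - f [\<mu> a b]"
  by (simp add: hoch_def)

lemma hoch_2: "hoch 2 f [a, b, c] =
    \<mu> (f [a, b]) c - \<mu> a (f [b, c]) + f [\<mu> a b, c] - f [a, \<mu> b c]"
proof -
  have "{1..2::nat} = {1, 2}" by auto
  then show ?thesis by (simp add: hoch_def)
qed

lemma mhoch_1: "mhoch 1 f [a, b] =
    \<mu> (R a) (f [b]) - R (\<mu> a (f [b])) + \<mu> (f [a]) (R b) - R (\<mu> (f [a]) b)
    - f [\<mu> (R a) b + \<mu> a (R b)]"
  by (simp add: mhoch_def)

lemma phi_1: "phi 1 f [a] = f [R a] - R (f [a])"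
proof -
  have odd: "{S. S \<subseteq> {..<1::nat} \<and> odd (card S)} = {{0}}"
    by (auto simp: lessThan_Suc subset_singleton_iff)
  have even: "{S. S \<subseteq> {..<1::nat} \<and> even (card S) \<and> 2 \<le> card S} = {}"
    by (auto simp: lessThan_Suc subset_singleton_iff)
  show ?thesis
    unfolding phi_def odd even R_except_def by simp
qed

lemma phi_2: "phi 2 f [a, b] =
    f [R a, R b] - R (f [a, R b]) - R (f [R a, b]) - \<kappa> *s f [a, b]"
proof -
  \<comment> \<open>Listing the four subsets lets their cardinalities be computed: the singletons
    give the two terms with an outer \<open>R\<close>, and the full set gives the factor
    \<open>- \<kappa>\<close>.\<close>
  have Pow_2: "Pow {..<2::nat} = {{}, {0}, {1}, {0, 1}}"
    by (simp add: numeral_2_eq_2 lessThan_Suc Pow_insert) blast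
  have sub: "S \<subseteq> {..<2} \<longleftrightarrow> S \<in> {{}, {0}, {1}, {0, 1}}" for S :: "nat set"
    by (simp only: Pow_iff [symmetric] Pow_2)
  have odd: "{S. S \<subseteq> {..<2::nat} \<and> odd (card S)} = {{0}, {1}}"
    unfolding sub by auto
  have even: "{S. S \<subseteq> {..<2::nat} \<and> even (card S) \<and> 2 \<le> card S} = {{0, 1}}"
    unfolding sub by auto
  have "[0..<2] = [0, 1::nat]"
    by (simp add: numeral_2_eq_2)
  then show ?thesis
    unfolding phi_def odd even R_except_def by simp
qed

lemma Delta_1: "Delta 1 f [a] = f [d a] - d (f [a])"
  by (simp add: Delta_def)

lemma Delta_2: "Delta 2 f [a, b] = f [d a, b] + f [a, d b] - d (f [a, b])"
  by (simp add: Delta_def numeral_2_eq_2)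

text \<open>The hypotheses are the linearised axioms (associativity, Rota-Baxter, derivation,
  commutation), one for each of the four components of the differential. They are arranged as
  equations between the two sides, as coefficient comparison yields them.\<close>

lemma diff_2_eq_0I:
  assumes E: "\<And>a b c. \<mu> (E a b) c + E (\<mu> a b) c = \<mu> a (E b c) + E a (\<mu> b c)"
    and RB: "\<And>a b. \<mu> (G a) (R b) + \<mu> (R a) (G b) + E (R a) (R b) =
      R (\<mu> (G a) b + \<mu> a (G b) + E (R a) b + E a (R b)) + G (\<mu> (R a) b + \<mu> a (R b))
      + \<kappa> *s E a b"
    and der: "\<And>a b. d (E a b) + H (\<mu> a b) = \<mu> (H a) b + \<mu> a (H b) + E (d a) b + E a (d b)"
    and comm: "\<And>a. R (H a) + G (d a) = d (G a) + H (R a)"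
  shows "mRBAD_diff 2 ((binary_cochain E, unary_cochain G), (unary_cochain H, 0)) = 0"
proof -
  have "hoch 2 (binary_cochain E) as = 0" for as
  proof (cases "length as = 3")
    case True
    then obtain a b c where "as = [a, b, c]"
      by (auto simp: numeral_3_eq_3 length_Suc_conv)
    then show ?thesis
      using E [of a b c] by (simp add: hoch_2 binary_cochain_def algebra_simps)
  qed (simp add: hoch_def)
  moreover have "- mhoch 1 (unary_cochain G) as - phi 2 (binary_cochain E) as = 0" for as
  proof (cases "length as = 2")
    case True
    then obtain a b where "as = [a, b]"
      by (auto simp: numeral_2_eq_2 length_Suc_conv)
    then show ?thesis
      using RB [of a b]
      by (simp add: mhoch_1 [unfolded One_nat_def] phi_2 binary_cochain_def unary_cochain_def
          module_hom.add [OF R_linear] algebra_simps)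
  qed (simp add: mhoch_def phi_def)
  moreover have "hoch 1 (unary_cochain H) as + Delta 2 (binary_cochain E) as = 0" for as
  proof (cases "length as = 2")
    case True
    then obtain a b where "as = [a, b]"
      by (auto simp: numeral_2_eq_2 length_Suc_conv)
    then show ?thesis
      using der [of a b]
      by (simp add: hoch_1 [unfolded One_nat_def] Delta_2 binary_cochain_def unary_cochain_def
          algebra_simps)
  qed (simp add: hoch_def Delta_def)
  moreover have "- phi 1 (unary_cochain H) as + Delta 1 (unary_cochain G) as = 0" for as
  proof (cases "length as = 1")
    case True
    then obtain a where "as = [a]"
      by (auto simp: length_Suc_conv)
    then show ?thesis
      using comm [of a]
      by (simp add: phi_1 [unfolded One_nat_def] Delta_1 [unfolded One_nat_def] unary_cochain_def
          algebra_simps)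
  qed (simp add: phi_def Delta_def)
  ultimately show ?thesis
    by (simp add: mRBAD_diff_def mRBAA_diff_def mRBAA_Delta_def fun_eq_iff zero_prod_def)
qed

lemma structure_maps_zero: "\<mu> 0 b = 0" "\<mu> a 0 = 0" "R 0 = 0" "d 0 = 0"
  using module_hom.zero [OF mu_linear_left] module_hom.zero [OF mu_linear_right]
    module_hom.zero [OF R_linear] module_hom.zero [OF d_linear] by simp_all

section \<open>Consequences of vanishing second cohomology\<close>

lemma zero_in_coboundaries_2: "0 \<in> mRBAD_coboundaries 2"
proof -
  have "hoch 1 0 = 0" "phi 1 0 = 0" "Delta 1 0 = 0"
    by (simp_all add: fun_eq_iff hoch_def phi_def Delta_def structure_maps_zero)
  then have "mRBAD_diff 1 0 = 0"
    by (simp add: mRBAD_diff_def mRBAA_diff_def mRBAA_Delta_def zero_prod_def)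
  moreover have "0 \<in> mRBAD_cochains 1"
    by (simp add: mRBAD_cochains_def mRBAA_cochains_def zero_prod_def
        zero_in_cochains [of 1, unfolded One_nat_def])
  ultimately show ?thesis
    by (force simp: mRBAD_coboundaries_def)
qed

lemma zero_in_cocycles_2: "0 \<in> mRBAD_cocycles 2"
proof -
  have "0 \<in> mRBAD_cochains 2"
    by (simp add: mRBAD_cochains_def mRBAA_cochains_def zero_prod_def zero_in_cochains
        zero_in_cochains [of 1, unfolded One_nat_def])
  moreover have "unary_cochain (\<lambda>_. 0) = 0" "binary_cochain (\<lambda>_ _. 0) = 0"
    by (simp_all add: unary_cochain_def binary_cochain_def fun_eq_iff)
  then have "mRBAD_diff 2 0 = 0"
    using diff_2_eq_0I [of "\<lambda>_ _. 0" "\<lambda>_. 0" "\<lambda>_. 0"]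
    by (simp add: structure_maps_zero zero_prod_def)
  ultimately show ?thesis by (simp add: mRBAD_cocycles_def)
qed

text \<open>The class of \<open>z\<close> can only be the class of 0, so it contains 0, which says
  that \<open>z - 0\<close> is a coboundary.\<close>

lemma cocycle_is_coboundary:
  assumes "cohomology 2 = {cohomology_class 2 0}" and z: "z \<in> mRBAD_cocycles 2"
  shows "z \<in> mRBAD_coboundaries 2"
proof -
  have "0 \<in> cohomology_class 2 0"
    using zero_in_coboundaries_2 zero_in_cocycles_2 by (simp add: cohomology_class_def cohomologous_def)
  moreover have "cohomology_class 2 z \<in> cohomology 2"
    using z by (simp add: cohomology_class_def cohomology_def quotientI)
  ultimately have "0 \<in> cohomology_class 2 z"
    using assms(1) by simp
  then show ?thesis
    by (simp add: cohomology_class_def cohomologous_def)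
qed

text \<open>The right-hand sides are the negatives of the changes that \<open>\<psi>\<close>, added
  in degree \<open>n\<close>, makes to the defects. Hence such a \<open>\<psi>\<close> cancels
  \<open>E\<close>, \<open>G\<close> and \<open>H\<close> together.\<close>

lemma coboundary_2E:
  assumes "((binary_cochain E, unary_cochain G), (unary_cochain H, 0)) \<in> mRBAD_coboundaries 2"
  obtains \<psi> where "module_hom scale scale \<psi>"
    and "\<And>a b. E a b = \<mu> a (\<psi> b) + \<mu> (\<psi> a) b - \<psi> (\<mu> a b)"
    and "\<And>a. G a = R (\<psi> a) - \<psi> (R a)"
    and "\<And>a. H a = d (\<psi> a) - \<psi> (d a)"
proof -
  obtain f where f: "f \<in> cochains 1" and E: "binary_cochain E = hoch 1 f"
    and G: "unary_cochain G = - phi 1 f" and H: "unary_cochain H = - Delta 1 f"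
    using assms by (auto simp: mRBAD_coboundaries_def mRBAD_cochains_def mRBAA_cochains_def
        mRBAD_diff_def mRBAA_diff_def mRBAA_Delta_def)
  show thesis
  proof
    show "module_hom scale scale (\<lambda>a. f [a])"
      using f by (rule cochains_1_module_hom)
    show "E a b = \<mu> a (f [b]) + \<mu> (f [a]) b - f [\<mu> a b]" for a b
      using fun_cong [OF E, of "[a, b]"] by (simp add: hoch_1 [unfolded One_nat_def] binary_cochain_def)
    show "G a = R (f [a]) - f [R a]" for a
      using fun_cong [OF G, of "[a]"] by (simp add: phi_1 [unfolded One_nat_def] unary_cochain_def)
    show "H a = d (f [a]) - f [d a]" for a
      using fun_cong [OF H, of "[a]"] by (simp add: Delta_1 [unfolded One_nat_def] unary_cochain_def)
  qed
qed


subsection \<open>Obstructions to trivialising a deformation\<close>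

text \<open>Defined on all series, because the axioms of the deformed pair are compared at arguments
  such as \<open>fps_map2 \<mu>t x y\<close>, which are not constant.\<close>

definition mult_defect ::
  "(nat \<Rightarrow> 'a \<Rightarrow> 'a \<Rightarrow> 'a) \<Rightarrow> (nat \<Rightarrow> 'a \<Rightarrow> 'a) \<Rightarrow> 'a fps \<Rightarrow> 'a fps \<Rightarrow> 'a fps" where
  "mult_defect \<mu>t \<phi> x y = fps_map \<phi> (fps_map2 \<mu>t x y)
    - fps_map2 (fps_constant_map \<mu>) (fps_map \<phi> x) (fps_map \<phi> y)"

definition map_defect ::
  "('a \<Rightarrow> 'a) \<Rightarrow> (nat \<Rightarrow> 'a \<Rightarrow> 'a) \<Rightarrow> (nat \<Rightarrow> 'a \<Rightarrow> 'a) \<Rightarrow> 'a fps \<Rightarrow> 'a fps" where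
  "map_defect F Ft \<phi> x =
    fps_map \<phi> (fps_map Ft x) - fps_map (fps_constant_map F) (fps_map \<phi> x)"

text \<open>Tested on constants only; \<open>t_linear_nth\<close> and \<open>t_bilinear_nth\<close>
  carry the vanishing over to arbitrary series.\<close>

definition trivialises_at ::
  "(nat \<Rightarrow> 'a \<Rightarrow> 'a \<Rightarrow> 'a) \<Rightarrow> (nat \<Rightarrow> 'a \<Rightarrow> 'a) \<Rightarrow> (nat \<Rightarrow> 'a \<Rightarrow> 'a) \<Rightarrow> (nat \<Rightarrow> 'a \<Rightarrow> 'a)
    \<Rightarrow> nat \<Rightarrow> bool" where
  "trivialises_at \<mu>t Rt dt \<phi> k \<longleftrightarrow>
    (\<forall>a b. fps_nth (mult_defect \<mu>t \<phi> (fps_const a) (fps_const b)) k = 0) \<and>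
    (\<forall>a. fps_nth (map_defect R Rt \<phi> (fps_const a)) k = 0) \<and>
    (\<forall>a. fps_nth (map_defect d dt \<phi> (fps_const a)) k = 0)"

text \<open>Coefficient \<open>k\<close> involves only the first \<open>k + 1\<close> terms of the
  series of maps, so those terms can be chosen recursively.\<close>

lemma trivialises_at_cong:
  assumes "\<And>i. i \<le> k \<Longrightarrow> \<phi> i = \<psi> i"
  shows "trivialises_at \<mu>t Rt dt \<phi> k = trivialises_at \<mu>t Rt dt \<psi> k"
proof -
  have "fps_nth (fps_map \<phi> x) j = fps_nth (fps_map \<psi> x) j" if "j \<le> k" for x j
    by (rule fps_map_cong_nth) (use assms that in auto)
  then show ?thesis
    by (simp add: trivialises_at_def mult_defect_def map_defect_def fps_map2_constant_nth)
qed

lemma module_hom_additive: "module_hom scale scale f \<Longrightarrow> additive f"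
  by (simp add: module_hom_iff additive_def)

end

text \<open>
  In \<open>partial_trivialisation\<close> the series \<open>\<phi>\<close> is arbitrary from degree \<open>n\<close> on, so the locale covers
  both the inductive step, where \<open>\<phi> n = 0\<close>, and a complete solution, taken at every \<open>n\<close>.
\<close>

locale partial_trivialisation = mRB_AssDer_pair scale \<mu> R d \<kappa>
  for scale :: "'k::comm_ring_1 \<Rightarrow> 'a::ab_group_add \<Rightarrow> 'a" (infixr \<open>*s\<close> 75)
    and \<mu> :: "'a \<Rightarrow> 'a \<Rightarrow> 'a"
    and R d :: "'a \<Rightarrow> 'a"
    and \<kappa> :: 'k +
  fixes \<mu>t :: "nat \<Rightarrow> 'a \<Rightarrow> 'a \<Rightarrow> 'a" and Rt dt \<phi> :: "nat \<Rightarrow> 'a \<Rightarrow> 'a" and n :: nat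
  assumes deformation: "deformation \<mu>t Rt dt"
    and phi_linear: "module_hom scale scale (\<phi> i)"
    and trivialises: "k < n \<Longrightarrow> trivialises_at \<mu>t Rt dt \<phi> k"
begin

lemma mut_linear_left: "module_hom scale scale (\<lambda>a. \<mu>t i a b)"
  and mut_linear_right: "module_hom scale scale (\<mu>t i a)"
  and Rt_linear: "module_hom scale scale (Rt i)"
  and dt_linear: "module_hom scale scale (dt i)"
  and mut_0: "\<mu>t 0 = \<mu>" and Rt_0: "Rt 0 = R" and dt_0: "dt 0 = d"
  using deformation by (simp_all add: deformation_def)

lemma additive_maps:
  "additive (\<lambda>a. \<mu>t i a b)" "additive (\<mu>t i a)" "additive (Rt i)" "additive (dt i)"
  "additive (\<phi> i)" "additive (\<lambda>a. \<mu> a b)" "additive (\<mu> a)" "additive R" "additive d"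
  by (rule module_hom_additive mut_linear_left mut_linear_right Rt_linear dt_linear phi_linear
      mu_linear_left mu_linear_right R_linear d_linear)+

lemma additive_constant_maps:
  "additive (\<lambda>a. fps_constant_map \<mu> i a b)" "additive (fps_constant_map \<mu> i a)"
  "additive (fps_constant_map R i)" "additive (fps_constant_map d i)"
  using additive_maps(6-9) by (auto simp: fps_constant_map_def additive_def)

sublocale deformed: mRB_AssDer_pair
  "fps_scale scale" "fps_map2 \<mu>t" "fps_map Rt" "fps_map dt" "fps_const \<kappa>"
  using deformation by (simp add: deformation_def)

lemmas t_linear_maps =
  t_linear_fps_map [OF additive_maps(3)] t_linear_fps_map [OF additive_maps(4)]
  t_linear_fps_map [OF additive_maps(5)]
  t_linear_fps_map2_left [OF additive_maps(1)] t_linear_fps_map2_right [OF additive_maps(2)]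
  t_linear_fps_map [OF additive_constant_maps(3)] t_linear_fps_map [OF additive_constant_maps(4)]
  t_linear_fps_map2_left [OF additive_constant_maps(1)]
  t_linear_fps_map2_right [OF additive_constant_maps(2)]

lemma phi_add: "fps_map \<phi> (x + y) = fps_map \<phi> x + fps_map \<phi> y"
  using t_linear_additive [OF t_linear_maps(3)] by (rule additive.add)

lemma phi_scale: "fps_nth (fps_map \<phi> (fps_scale scale (fps_const c) x)) k
    = c *s fps_nth (fps_map \<phi> x) k"
proof -
  have "fps_nth (fps_scale scale (fps_const c) x) k = c *s fps_nth x k" for k
  proof -
    have "fps_nth (fps_scale scale (fps_const c) x) k
        = (\<Sum>i\<le>k. if i = 0 then c *s fps_nth x (k - i) else 0)"
      unfolding fps_scale_def fps_nth_Abs_fps by (rule sum.cong) auto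
    then show ?thesis by simp
  qed
  then show ?thesis
    by (simp add: fps_map_nth module_hom.scale [OF phi_linear] scale_sum_right)
qed

section \<open>The defects in degree \<open>n\<close>\<close>

definition E :: "'a \<Rightarrow> 'a \<Rightarrow> 'a" where
  "E a b = fps_nth (mult_defect \<mu>t \<phi> (fps_const a) (fps_const b)) n"

definition G :: "'a \<Rightarrow> 'a" where
  "G a = fps_nth (map_defect R Rt \<phi> (fps_const a)) n"

definition H :: "'a \<Rightarrow> 'a" where
  "H a = fps_nth (map_defect d dt \<phi> (fps_const a)) n"

text \<open>The defect is t-bilinear and vanishes on constants below degree \<open>n\<close>. At
  \<open>k = n\<close> this makes the obstruction a function of the constant terms alone, hence a
  cochain on the original algebra.\<close>

lemma mult_defect_nth:
  assumes "k \<le> n"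
  shows "fps_nth (mult_defect \<mu>t \<phi> x y) k =
    fps_nth (mult_defect \<mu>t \<phi> (fps_const (fps_nth x 0)) (fps_const (fps_nth y 0))) k"
proof (rule t_bilinear_nth [OF _ _ _ assms])
  show "t_linear (\<lambda>x. mult_defect \<mu>t \<phi> x y)" for y
    unfolding mult_defect_def
    by (rule t_linear_diff [OF t_linear_compose [OF t_linear_maps(3,4)]
          t_linear_compose [OF t_linear_maps(8,3)]])
  show "t_linear (mult_defect \<mu>t \<phi> x)" for x
    unfolding mult_defect_def
    by (rule t_linear_diff [OF t_linear_compose [OF t_linear_maps(3,5)]
          t_linear_compose [OF t_linear_maps(9,3)]])
  show "fps_nth (mult_defect \<mu>t \<phi> (fps_const a) (fps_const b)) k = 0" if "k < n" for a b k
    using trivialises [OF that] by (simp add: trivialises_at_def)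
qed

lemma map_defect_nth:
  assumes "k \<le> n"
  shows "fps_nth (map_defect R Rt \<phi> x) k
      = fps_nth (map_defect R Rt \<phi> (fps_const (fps_nth x 0))) k"
    and "fps_nth (map_defect d dt \<phi> x) k
      = fps_nth (map_defect d dt \<phi> (fps_const (fps_nth x 0))) k"
proof -
  have "t_linear (map_defect R Rt \<phi>)" "t_linear (map_defect d dt \<phi>)"
    unfolding map_defect_def
    by (rule t_linear_diff [OF t_linear_compose [OF t_linear_maps(3,1)]
          t_linear_compose [OF t_linear_maps(6,3)]],
        rule t_linear_diff [OF t_linear_compose [OF t_linear_maps(3,2)]
          t_linear_compose [OF t_linear_maps(7,3)]])
  moreover have "fps_nth (map_defect R Rt \<phi> (fps_const a)) k = 0"
    "fps_nth (map_defect d dt \<phi> (fps_const a)) k = 0" if "k < n" for a k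
    using trivialises [OF that] by (simp_all add: trivialises_at_def)
  ultimately show "fps_nth (map_defect R Rt \<phi> x) k
      = fps_nth (map_defect R Rt \<phi> (fps_const (fps_nth x 0))) k"
    and "fps_nth (map_defect d dt \<phi> x) k
      = fps_nth (map_defect d dt \<phi> (fps_const (fps_nth x 0))) k"
    using assms by (blast intro: t_linear_nth)+
qed

lemma phi_mut_below:
  "k < n \<Longrightarrow> fps_nth (fps_map \<phi> (fps_map2 \<mu>t x y)) k
    = fps_nth (fps_map2 (fps_constant_map \<mu>) (fps_map \<phi> x) (fps_map \<phi> y)) k"
  using mult_defect_nth [of k x y] trivialises [of k]
  \<comment> \<open>The defect stays folded in the first call, so that its vanishing on constants
    can rewrite it; only then is it unfolded.\<close>
  by (simp add: trivialises_at_def) (simp add: mult_defect_def)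

lemma phi_Rt_below: "k < n \<Longrightarrow> fps_nth (fps_map \<phi> (fps_map Rt x)) k = R (fps_nth (fps_map \<phi> x) k)"
  using map_defect_nth(1) [of k x] trivialises [of k]
  by (simp add: trivialises_at_def) (simp add: map_defect_def)

lemma phi_dt_below: "k < n \<Longrightarrow> fps_nth (fps_map \<phi> (fps_map dt x)) k = d (fps_nth (fps_map \<phi> x) k)"
  using map_defect_nth(2) [of k x] trivialises [of k]
  by (simp add: trivialises_at_def) (simp add: map_defect_def)

lemma phi_mut_nth: "fps_nth (fps_map \<phi> (fps_map2 \<mu>t x y)) n
    = fps_nth (fps_map2 (fps_constant_map \<mu>) (fps_map \<phi> x) (fps_map \<phi> y)) n
      + E (fps_nth x 0) (fps_nth y 0)"
  using mult_defect_nth [of n x y] unfolding E_def [symmetric]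
  by (simp add: mult_defect_def algebra_simps)

lemma phi_Rt_nth: "fps_nth (fps_map \<phi> (fps_map Rt x)) n
    = R (fps_nth (fps_map \<phi> x) n) + G (fps_nth x 0)"
  using map_defect_nth(1) [of n x] unfolding G_def [symmetric]
  by (simp add: map_defect_def algebra_simps)

lemma phi_dt_nth: "fps_nth (fps_map \<phi> (fps_map dt x)) n
    = d (fps_nth (fps_map \<phi> x) n) + H (fps_nth x 0)"
  using map_defect_nth(2) [of n x] unfolding H_def [symmetric]
  by (simp add: map_defect_def algebra_simps)

lemma fps_map2_mut_nth_0: "fps_nth (fps_map2 \<mu>t x y) 0 = \<mu> (fps_nth x 0) (fps_nth y 0)"
  and fps_map_Rt_nth_0: "fps_nth (fps_map Rt x) 0 = R (fps_nth x 0)"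
  and fps_map_dt_nth_0: "fps_nth (fps_map dt x) 0 = d (fps_nth x 0)"
  by (simp_all add: fps_map2_nth fps_map_nth mut_0 Rt_0 dt_0)

text \<open>In this explicit form, linearity in each argument can be read off termwise.\<close>

lemma E_eq: "E a b = (\<Sum>i\<le>n. \<phi> i (\<mu>t (n - i) a b)) - (\<Sum>j\<le>n. \<mu> (\<phi> j a) (\<phi> (n - j) b))"
  by (simp add: E_def mult_defect_def fps_map_nth [of \<phi> "fps_map2 \<mu>t _ _"] fps_map2_constant_nth
      fps_map_fps_const_nth additive_maps fps_map2_fps_const_nth)

lemma E_linear_left: "module_hom scale scale (\<lambda>a. E a b)"
  by (simp add: E_eq module_hom_iff module_axioms sum.distrib scale_sum_right
      scale_right_diff_distrib module_hom.add [OF phi_linear] module_hom.scale [OF phi_linear]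
      module_hom.add [OF mut_linear_left] module_hom.scale [OF mut_linear_left]
      module_hom.add [OF mu_linear_left] module_hom.scale [OF mu_linear_left])

lemma E_linear_right: "module_hom scale scale (E a)"
  by (simp add: E_eq module_hom_iff module_axioms sum.distrib scale_sum_right
      scale_right_diff_distrib module_hom.add [OF phi_linear] module_hom.scale [OF phi_linear]
      module_hom.add [OF mut_linear_right] module_hom.scale [OF mut_linear_right]
      module_hom.add [OF mu_linear_right] module_hom.scale [OF mu_linear_right])

lemma G_linear: "module_hom scale scale G"
  by (simp add: G_def map_defect_def fps_map_nth [of \<phi> "fps_map _ _"] fps_map_fps_const_nth
      additive_maps module_hom_iff module_axioms sum.distrib scale_sum_right
      scale_right_diff_distrib module_hom.add [OF phi_linear] module_hom.scale [OF phi_linear]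
      module_hom.add [OF Rt_linear] module_hom.scale [OF Rt_linear]
      module_hom.add [OF R_linear] module_hom.scale [OF R_linear])

lemma H_linear: "module_hom scale scale H"
  by (simp add: H_def map_defect_def fps_map_nth [of \<phi> "fps_map _ _"] fps_map_fps_const_nth
      additive_maps module_hom_iff module_axioms sum.distrib scale_sum_right
      scale_right_diff_distrib module_hom.add [OF phi_linear] module_hom.scale [OF phi_linear]
      module_hom.add [OF dt_linear] module_hom.scale [OF dt_linear]
      module_hom.add [OF d_linear] module_hom.scale [OF d_linear])

section \<open>The undeformed structure extended to power series\<close>

abbreviation Phi :: "'a fps \<Rightarrow> 'a fps" (\<open>\<Phi>\<close>) where
  "\<Phi> \<equiv> fps_map \<phi>"

abbreviation mult0 :: "'a fps \<Rightarrow> 'a fps \<Rightarrow> 'a fps" (infixl \<open>\<star>\<close> 70) where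
  "x \<star> y \<equiv> fps_map2 (fps_constant_map \<mu>) x y"

lemma mult0_assoc: "(x \<star> y) \<star> z = x \<star> (y \<star> z)"
  by (rule fps_map2_constant_assoc) (use additive_maps mu_assoc in auto)

text \<open>Stated coefficientwise, so that the outer \<open>R\<close> and \<open>\<kappa>\<close>
  act on the original module, as they do in \<open>phi_Rt_nth\<close> and
  \<open>phi_scale\<close>.\<close>

lemma mult0_Rota_Baxter:
  fixes x y
  defines "R0 \<equiv> fps_map (fps_constant_map R)"
  shows "fps_nth (R0 x \<star> R0 y) k = R (fps_nth (R0 x \<star> y) k + fps_nth (x \<star> R0 y) k)
    + \<kappa> *s fps_nth (x \<star> y) k"
  by (simp add: R0_def fps_map2_constant_nth modified_Rota_Baxter sum.distrib scale_sum_right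
      additive.sum [OF additive_maps(8)] additive.add [OF additive_maps(8)])

lemma mult0_derivation:
  fixes x y
  defines "d0 \<equiv> fps_map (fps_constant_map d)"
  shows "d (fps_nth (x \<star> y) k) = fps_nth (d0 x \<star> y) k + fps_nth (x \<star> d0 y) k"
  by (simp add: d0_def fps_map2_constant_nth derivation sum.distrib additive.sum [OF additive_maps(9)])

text \<open>Meant for factors such as \<open>\<Phi> (fps_map Rt x)\<close>, which equals
  \<open>R\<close> applied to \<open>\<Phi> x\<close> except for an error in degree
  \<open>n\<close>.\<close>

lemma mult0_perturb:
  assumes "0 < n"
    and "\<And>k. k < n \<Longrightarrow> fps_nth x k = fps_nth x' k" "fps_nth x n = fps_nth x' n + e"
    and "\<And>k. k < n \<Longrightarrow> fps_nth y k = fps_nth y' k" "fps_nth y n = fps_nth y' n + f"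
  shows "fps_nth (x \<star> y) n = fps_nth (x' \<star> y') n + \<mu> e (fps_nth y 0) + \<mu> (fps_nth x 0) f"
  using fps_map2_constant_perturb [of \<mu> n x x' y y'] assms additive_maps(6,7) by simp

lemma mult0_perturb_left:
  assumes "0 < n"
    and "\<And>k. k < n \<Longrightarrow> fps_nth x k = fps_nth x' k" "fps_nth x n = fps_nth x' n + e"
  shows "fps_nth (x \<star> y) n = fps_nth (x' \<star> y) n + \<mu> e (fps_nth y 0)"
  using mult0_perturb [OF assms, of y y 0] by (simp add: additive.zero [OF additive_maps(7)])

lemma mult0_perturb_right:
  assumes "0 < n"
    and "\<And>k. k < n \<Longrightarrow> fps_nth y k = fps_nth y' k" "fps_nth y n = fps_nth y' n + f"
  shows "fps_nth (x \<star> y) n = fps_nth (x \<star> y') n + \<mu> (fps_nth x 0) f"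
  using mult0_perturb [OF assms(1) _ _ assms(2,3), of x x 0]
  by (simp add: additive.zero [OF additive_maps(6)])

section \<open>The cocycle identities and the inductive step\<close>

context
  assumes n_pos: "0 < n" and phi_0: "\<phi> 0 = id"
begin

text \<open>This is where \<open>\<phi> 0 = id\<close> enters: the error terms below are evaluated
  at unmodified constant terms.\<close>

lemma Phi_nth_0: "fps_nth (\<Phi> x) 0 = fps_nth x 0"
  by (simp add: fps_map_nth phi_0)

lemmas nth_0 = Phi_nth_0 fps_map2_mut_nth_0 fps_map_Rt_nth_0 fps_map_dt_nth_0

text \<open>Under \<open>\<Phi>\<close>, each bracketing of the deformed triple product becomes the
  undeformed one of \<open>\<Phi> a\<close>, \<open>\<Phi> b\<close>, \<open>\<Phi> c\<close> plus
  two error terms. The undeformed products cancel by associativity.\<close>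

lemma E_cocycle: "\<mu> (E a b) c + E (\<mu> a b) c = \<mu> a (E b c) + E a (\<mu> b c)"
proof -
  let ?a = "fps_const a" and ?b = "fps_const b" and ?c = "fps_const c"
  have "fps_nth (\<Phi> (fps_map2 \<mu>t ?a ?b) \<star> \<Phi> ?c) n
      = fps_nth ((\<Phi> ?a \<star> \<Phi> ?b) \<star> \<Phi> ?c) n + \<mu> (E a b) c"
    using mult0_perturb_left [OF n_pos phi_mut_below phi_mut_nth, of ?a ?b "\<Phi> ?c"]
    by (simp add: nth_0)
  moreover have "fps_nth (\<Phi> ?a \<star> \<Phi> (fps_map2 \<mu>t ?b ?c)) n
      = fps_nth (\<Phi> ?a \<star> (\<Phi> ?b \<star> \<Phi> ?c)) n + \<mu> a (E b c)"
    using mult0_perturb_right [OF n_pos phi_mut_below phi_mut_nth, of "\<Phi> ?a" ?b ?c]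
    by (simp add: nth_0)
  moreover have "fps_nth (\<Phi> (fps_map2 \<mu>t (fps_map2 \<mu>t ?a ?b) ?c)) n
      = fps_nth (\<Phi> (fps_map2 \<mu>t ?a (fps_map2 \<mu>t ?b ?c))) n"
    by (simp only: deformed.mu_assoc)
  ultimately show ?thesis
    by (simp add: phi_mut_nth nth_0 mult0_assoc)
qed

lemma Rota_Baxter_cocycle:
  "\<mu> (G a) (R b) + \<mu> (R a) (G b) + E (R a) (R b) =
    R (\<mu> (G a) b + \<mu> a (G b) + E (R a) b + E a (R b)) + G (\<mu> (R a) b + \<mu> a (R b)) + \<kappa> *s E a b"
proof -
  let ?a = "fps_const a" and ?b = "fps_const b" and ?R0 = "fps_map (fps_constant_map R)"
  let ?L = "fps_map2 \<mu>t (fps_map Rt ?a) ?b" and ?Q = "fps_map2 \<mu>t ?a (fps_map Rt ?b)"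
  \<comment> \<open>These are the hypotheses of \<open>mult0_perturb\<close>, with error
    \<open>G\<close> in degree \<open>n\<close>.\<close>
  have agree: "k < n \<Longrightarrow> fps_nth (\<Phi> (fps_map Rt x)) k = fps_nth (?R0 (\<Phi> x)) k"
    and top: "fps_nth (\<Phi> (fps_map Rt x)) n = fps_nth (?R0 (\<Phi> x)) n + G (fps_nth x 0)" for x k
    by (simp_all add: phi_Rt_below phi_Rt_nth)
  have "fps_nth (\<Phi> (fps_map Rt ?a) \<star> \<Phi> (fps_map Rt ?b)) n
      = fps_nth (?R0 (\<Phi> ?a) \<star> ?R0 (\<Phi> ?b)) n + \<mu> (G a) (R b) + \<mu> (R a) (G b)"
    using mult0_perturb [OF n_pos agree top agree top, of ?a ?b] by (simp add: nth_0)
  then have lhs: "fps_nth (\<Phi> (fps_map2 \<mu>t (fps_map Rt ?a) (fps_map Rt ?b))) n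
      = fps_nth (?R0 (\<Phi> ?a) \<star> ?R0 (\<Phi> ?b)) n + \<mu> (G a) (R b) + \<mu> (R a) (G b) + E (R a) (R b)"
    by (simp add: phi_mut_nth nth_0)
  have "fps_nth (\<Phi> (fps_map Rt ?a) \<star> \<Phi> ?b) n = fps_nth (?R0 (\<Phi> ?a) \<star> \<Phi> ?b) n + \<mu> (G a) b"
    using mult0_perturb_left [OF n_pos agree top, of ?a "\<Phi> ?b"] by (simp add: nth_0)
  then have L: "fps_nth (\<Phi> ?L) n = fps_nth (?R0 (\<Phi> ?a) \<star> \<Phi> ?b) n + \<mu> (G a) b + E (R a) b"
    by (simp add: phi_mut_nth nth_0)
  have "fps_nth (\<Phi> ?a \<star> \<Phi> (fps_map Rt ?b)) n = fps_nth (\<Phi> ?a \<star> ?R0 (\<Phi> ?b)) n + \<mu> a (G b)"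
    using mult0_perturb_right [OF n_pos agree top, of "\<Phi> ?a" ?b] by (simp add: nth_0)
  then have Q: "fps_nth (\<Phi> ?Q) n = fps_nth (\<Phi> ?a \<star> ?R0 (\<Phi> ?b)) n + \<mu> a (G b) + E a (R b)"
    by (simp add: phi_mut_nth nth_0)
  have "fps_nth (\<Phi> (fps_map2 \<mu>t (fps_map Rt ?a) (fps_map Rt ?b))) n
      = fps_nth (\<Phi> (fps_map Rt (?L + ?Q) + fps_scale scale (fps_const \<kappa>) (fps_map2 \<mu>t ?a ?b))) n"
    by (simp only: deformed.modified_Rota_Baxter)
  \<comment> \<open>The outer \<open>Rt\<close> contributes \<open>G\<close> at the constant term of
    its argument.\<close>
  also have "\<dots> = R (fps_nth (\<Phi> ?L) n + fps_nth (\<Phi> ?Q) n) + G (\<mu> (R a) b + \<mu> a (R b))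
      + \<kappa> *s (fps_nth (\<Phi> ?a \<star> \<Phi> ?b) n + E a b)"
    by (simp add: phi_add phi_scale phi_Rt_nth phi_mut_nth nth_0)
  finally show ?thesis
    \<comment> \<open>The undeformed Rota-Baxter identity removes every term free of
      \<open>E\<close> and \<open>G\<close>.\<close>
    unfolding lhs L Q mult0_Rota_Baxter
    by (simp add: module_hom.add [OF R_linear] scale_right_distrib algebra_simps)
qed

lemma derivation_cocycle:
  "d (E a b) + H (\<mu> a b) = \<mu> (H a) b + \<mu> a (H b) + E (d a) b + E a (d b)"
proof -
  let ?a = "fps_const a" and ?b = "fps_const b" and ?d0 = "fps_map (fps_constant_map d)"
  have agree: "k < n \<Longrightarrow> fps_nth (\<Phi> (fps_map dt x)) k = fps_nth (?d0 (\<Phi> x)) k"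
    and top: "fps_nth (\<Phi> (fps_map dt x)) n = fps_nth (?d0 (\<Phi> x)) n + H (fps_nth x 0)" for x k
    by (simp_all add: phi_dt_below phi_dt_nth)
  have "fps_nth (\<Phi> (fps_map dt ?a) \<star> \<Phi> ?b) n = fps_nth (?d0 (\<Phi> ?a) \<star> \<Phi> ?b) n + \<mu> (H a) b"
    using mult0_perturb_left [OF n_pos agree top, of ?a "\<Phi> ?b"] by (simp add: nth_0)
  moreover have "fps_nth (\<Phi> ?a \<star> \<Phi> (fps_map dt ?b)) n
      = fps_nth (\<Phi> ?a \<star> ?d0 (\<Phi> ?b)) n + \<mu> a (H b)"
    using mult0_perturb_right [OF n_pos agree top, of "\<Phi> ?a" ?b] by (simp add: nth_0)
  moreover have "fps_nth (\<Phi> (fps_map dt (fps_map2 \<mu>t ?a ?b))) n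
      = fps_nth (\<Phi> (fps_map2 \<mu>t (fps_map dt ?a) ?b + fps_map2 \<mu>t ?a (fps_map dt ?b))) n"
    by (simp only: deformed.derivation)
  ultimately show ?thesis
    by (simp add: phi_add phi_mut_nth phi_dt_nth nth_0 module_hom.add [OF d_linear]
        mult0_derivation algebra_simps)
qed

text \<open>Moving \<open>\<Phi>\<close> inside both composites leaves \<open>R\<close> and
  \<open>d\<close> applied to \<open>\<Phi> a\<close> in either order, which cancel, and the four
  error terms.\<close>

lemma commutation_cocycle: "R (H a) + G (d a) = d (G a) + H (R a)"
proof -
  let ?a = "fps_const a"
  have "fps_nth (\<Phi> (fps_map Rt (fps_map dt ?a))) n = fps_nth (\<Phi> (fps_map dt (fps_map Rt ?a))) n"
    using deformed.R_d_commute by (simp add: fun_eq_iff)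
  moreover have "R (d x) = d (R x)" for x
    using R_d_commute by (simp add: fun_eq_iff)
  ultimately show ?thesis
    by (simp add: phi_Rt_nth phi_dt_nth nth_0 module_hom.add [OF d_linear]
        module_hom.add [OF R_linear])
qed

lemma defects_in_cocycles:
  "((binary_cochain E, unary_cochain G), (unary_cochain H, 0)) \<in> mRBAD_cocycles 2"
proof -
  have "binary_cochain E \<in> cochains 2"
    by (rule binary_cochain_in_cochains) (rule E_linear_left E_linear_right)+
  then show ?thesis
    using unary_cochain_in_cochains [OF G_linear] unary_cochain_in_cochains [OF H_linear]
      diff_2_eq_0I [of E G H] E_cocycle Rota_Baxter_cocycle derivation_cocycle commutation_cocycle
    by (simp add: mRBAD_cocycles_def mRBAD_cochains_def mRBAA_cochains_def)
qed

text \<open>Putting \<open>\<psi>\<close> in the empty slot \<open>n\<close> subtracts its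
  coboundary from the degree \<open>n\<close> defects, which are that coboundary.\<close>

lemma trivialisation_step:
  assumes "cohomology 2 = {cohomology_class 2 0}" and "\<phi> n = 0"
  shows "\<exists>\<psi>. module_hom scale scale \<psi> \<and> trivialises_at \<mu>t Rt dt (\<phi>(n := \<psi>)) n"
proof -
  obtain \<psi> where \<psi>: "module_hom scale scale \<psi>"
    and E: "\<And>a b. E a b = \<mu> a (\<psi> b) + \<mu> (\<psi> a) b - \<psi> (\<mu> a b)"
    and G: "\<And>a. G a = R (\<psi> a) - \<psi> (R a)"
    and H: "\<And>a. H a = d (\<psi> a) - \<psi> (d a)"
    using coboundary_2E [OF cocycle_is_coboundary [OF assms(1) defects_in_cocycles]] by blast
  let ?\<Psi> = "fps_map (\<phi>(n := \<psi>))"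
  have top: "fps_nth (?\<Psi> x) n = fps_nth (\<Phi> x) n + \<psi> (fps_nth x 0)" for x
    using assms(2) by (rule fps_map_fun_upd_nth)
  have below: "fps_nth (?\<Psi> x) k = fps_nth (\<Phi> x) k" if "k < n" for x k
    by (rule fps_map_cong_nth) (use that in auto)
  have "trivialises_at \<mu>t Rt dt (\<phi>(n := \<psi>)) n"
    unfolding trivialises_at_def
  proof (intro conjI allI)
    fix a b
    have "fps_nth (?\<Psi> (fps_const a) \<star> ?\<Psi> (fps_const b)) n
        = fps_nth (\<Phi> (fps_const a) \<star> \<Phi> (fps_const b)) n + \<mu> (\<psi> a) b + \<mu> a (\<psi> b)"
      \<comment> \<open>Here \<open>\<psi>\<close> enters through both factors, giving two of the
        three terms of the coboundary; the third comes from \<open>top\<close> applied to the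
        deformed product.\<close>
      using mult0_perturb [OF n_pos below top below top, of "fps_const a" "fps_const b"]
      by (simp add: below [OF n_pos] nth_0)
    then show "fps_nth (mult_defect \<mu>t (\<phi>(n := \<psi>)) (fps_const a) (fps_const b)) n = 0"
      by (simp add: mult_defect_def top phi_mut_nth nth_0 E)
  next
    fix a
    show "fps_nth (map_defect R Rt (\<phi>(n := \<psi>)) (fps_const a)) n = 0"
      by (simp add: map_defect_def top phi_Rt_nth nth_0 G module_hom.add [OF R_linear])
    show "fps_nth (map_defect d dt (\<phi>(n := \<psi>)) (fps_const a)) n = 0"
      by (simp add: map_defect_def top phi_dt_nth nth_0 H module_hom.add [OF d_linear])
  qed
  with \<psi> show ?thesis by blast
qed

end

end

section \<open>Recursive construction of the equivalence\<close>

context mRB_AssDer_pair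
begin

lemma trivialises_at_0: "deformation \<mu>t Rt dt \<Longrightarrow> \<phi> 0 = id \<Longrightarrow> trivialises_at \<mu>t Rt dt \<phi> 0"
  by (simp add: trivialises_at_def mult_defect_def map_defect_def deformation_def fps_map_nth
      fps_map2_nth fps_constant_map_def)

lemma exists_trivialisation:
  assumes H2: "cohomology 2 = {cohomology_class 2 0}" and def: "deformation \<mu>t Rt dt"
  shows "\<exists>\<phi>. (\<forall>i. module_hom scale scale (\<phi> i)) \<and> \<phi> 0 = id
    \<and> (\<forall>k. trivialises_at \<mu>t Rt dt \<phi> k)"
proof -
  \<comment> \<open>The update \<open>f(k := r)\<close> makes the condition depend only on
    \<open>r\<close> and the values of \<open>f\<close> below \<open>k\<close>, as well-founded
    choice requires. The case \<open>k = 0\<close> forces the initial term.\<close>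
  define P where "P f k r \<longleftrightarrow> module_hom scale scale r \<and> (k = 0 \<longrightarrow> r = id)
    \<and> trivialises_at \<mu>t Rt dt (f(k := r)) k" for f k r
  have "\<exists>\<phi>. \<forall>k. P \<phi> k (\<phi> k)"
  proof (rule dependent_wf_choice [OF wf_less_than])
    fix f g :: "nat \<Rightarrow> 'a \<Rightarrow> 'a" and k r
    assume "\<And>j. (j, k) \<in> less_than \<Longrightarrow> f j = g j"
    then have "trivialises_at \<mu>t Rt dt (f(k := r)) k = trivialises_at \<mu>t Rt dt (g(k := r)) k"
      by (intro trivialises_at_cong) auto
    then show "P f k r = P g k r" by (simp add: P_def)
  next
    fix k f
    assume IH: "\<And>j. (j, k) \<in> less_than \<Longrightarrow> P f j (f j)"
    show "\<exists>r. P f k r"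
    proof (cases "k = 0")
      case True
      then have "P f k id"
        using trivialises_at_0 [OF def, of "f(0 := id)"] by (simp add: P_def module_hom_id)
      then show ?thesis by blast
    next
      case False
      \<comment> \<open>Nothing is known about \<open>f\<close> from \<open>k\<close> on. Truncating
        makes all terms linear and leaves slot \<open>k\<close> zero, as
        \<open>trivialisation_step\<close> expects.\<close>
      define g where "g i = (if i < k then f i else 0)" for i
      have prev: "module_hom scale scale (f i)" "trivialises_at \<mu>t Rt dt f i" if "i < k" for i
        using IH [of i] that by (simp_all add: P_def)
      interpret partial_trivialisation scale \<mu> R d \<kappa> \<mu>t Rt dt g k
      proof (intro partial_trivialisation.intro partial_trivialisation_axioms.intro
          mRB_AssDer_pair_axioms)
        show "deformation \<mu>t Rt dt" by (rule def)
        show "module_hom scale scale (g i)" for i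
          using prev by (simp add: g_def module_hom_iff module_axioms)
        show "trivialises_at \<mu>t Rt dt g i" if "i < k" for i
          using prev(2) [OF that] trivialises_at_cong [of i g f] that by (simp add: g_def)
      qed
      have "g 0 = id" "g k = 0"
        using False IH [of 0] by (simp_all add: g_def P_def)
      then obtain \<psi> where \<psi>: "module_hom scale scale \<psi>" "trivialises_at \<mu>t Rt dt (g(k := \<psi>)) k"
        using trivialisation_step [OF _ _ H2] False by auto
      moreover have "trivialises_at \<mu>t Rt dt (g(k := \<psi>)) k = trivialises_at \<mu>t Rt dt (f(k := \<psi>)) k"
        by (rule trivialises_at_cong) (auto simp: g_def)
      ultimately have "P f k \<psi>"
        using False by (simp add: P_def)
      then show ?thesis by blast
    qed
  qed
  then obtain \<phi> where "\<And>k. P \<phi> k (\<phi> k)" by blast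
  then show ?thesis
    unfolding P_def fun_upd_triv by blast
qed

lemma rigidI:
  assumes H2: "cohomology 2 = {cohomology_class 2 0}"
  shows rigid
  unfolding rigid_def
proof (intro allI impI)
  fix \<mu>t Rt dt
  assume def: "deformation \<mu>t Rt dt"
  then obtain \<phi> where lin: "\<And>i. module_hom scale scale (\<phi> i)" and "\<phi> 0 = id"
    and triv: "\<And>k. trivialises_at \<mu>t Rt dt \<phi> k"
    using exists_trivialisation [OF H2] by blast
  \<comment> \<open>All degrees are trivialised, so \<open>n\<close> is free; taking it equal to the
    degree under inspection shows that the defects vanish on all series.\<close>
  have pt: "partial_trivialisation scale \<mu> R d \<kappa> \<mu>t Rt dt \<phi> n" for n
    by (intro partial_trivialisation.intro partial_trivialisation_axioms.intro
        mRB_AssDer_pair_axioms def lin triv)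
  have "mult_defect \<mu>t \<phi> x y = 0" "map_defect R Rt \<phi> x = 0" "map_defect d dt \<phi> x = 0" for x y
    using partial_trivialisation.mult_defect_nth [OF pt, OF order_refl]
      partial_trivialisation.map_defect_nth [OF pt, OF order_refl] triv
    by (simp_all add: fps_eq_iff trivialises_at_def)
  then show "equivalent_deformations \<mu>t Rt dt
      (fps_constant_map \<mu>) (fps_constant_map R) (fps_constant_map d)"
    unfolding equivalent_deformations_def mult_defect_def map_defect_def
    using lin \<open>\<phi> 0 = id\<close> by (intro exI [of _ \<phi>]) (simp add: fun_eq_iff)
qed

end

theorem theorem4p7:
  fixes scale :: "'k::field \<Rightarrow> 'a::ab_group_add \<Rightarrow> 'a"
    and \<mu> :: "'a \<Rightarrow> 'a \<Rightarrow> 'a"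
    and R d :: "'a \<Rightarrow> 'a"
    and \<kappa> :: 'k
  assumes "mRB_AssDer_pair scale \<mu> R d \<kappa>"
    and "mRB_AssDer_pair.cohomology scale \<mu> R d \<kappa> 2 =
      {mRB_AssDer_pair.cohomology_class scale \<mu> R d \<kappa> 2 0}"
  shows "mRB_AssDer_pair.rigid scale \<mu> R d \<kappa>"
  using assms by (rule mRB_AssDer_pair.rigidI)

end
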